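(* If $A$ is a profinite algebra which is left semiartinian and left selfinjective, then $A$ is a finite dimensional quasi-Frobenius algebra.
   Context: A profinite algebra is an algebra over a field which is an inverse limit of finite dimensional algebras (equivalently, the dual algebra $C^*$ of a coalgebra $C$). A ring is left semiartinian if every nonzero left module (equivalently every nonzero quotient of the ring as left module) has a nonzero socle. A ring is quasi-Frobenius if it is left (equivalently right) selfinjective and left (equivalently right) artinian. *)

theory Defs
  imports "HOL-Algebra.Module" "HOL-Algebra.Ideal"
begin

definition k_algebra :: "('k, 'm) ring_scheme \<Rightarrow> ('k, 'a, 'n) module_scheme \<Rightarrow> bool" where
  "k_algebra K A \<longleftrightarrow> field K \<and> module K A \<and> ring A \<and>
     (\<forall>c\<in>carrier K. \<forall>x\<in>carrier A. \<forall>y\<in>carrier A.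
        (c \<odot>\<^bsub>A\<^esub> x) \<otimes>\<^bsub>A\<^esub> y = c \<odot>\<^bsub>A\<^esub> (x \<otimes>\<^bsub>A\<^esub> y) \<and>
        x \<otimes>\<^bsub>A\<^esub> (c \<odot>\<^bsub>A\<^esub> y) = c \<odot>\<^bsub>A\<^esub> (x \<otimes>\<^bsub>A\<^esub> y))"

definition fin_codim :: "('k, 'm) ring_scheme \<Rightarrow> ('k, 'a, 'n) module_scheme \<Rightarrow> 'a set \<Rightarrow> bool" where
  "fin_codim K A I \<longleftrightarrow> (\<exists>S. finite S \<and> S \<subseteq> carrier A \<and>
     (\<forall>x\<in>carrier A. \<exists>c. c \<in> S \<rightarrow> carrier K \<and>
        (\<exists>i\<in>I. x = (\<Oplus>\<^bsub>A\<^esub>s\<in>S. c s \<odot>\<^bsub>A\<^esub> s) \<oplus>\<^bsub>A\<^esub> i)))"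

definition fin_dim :: "('k, 'm) ring_scheme \<Rightarrow> ('k, 'a, 'n) module_scheme \<Rightarrow> bool" where
  "fin_dim K A \<longleftrightarrow> fin_codim K A {\<zero>\<^bsub>A\<^esub>}"

text \<open>Profinite algebra: A is (canonically isomorphic to) the inverse limit of its
  finite dimensional quotients A/I, I ranging over a downward directed family of two-sided
  ideals of finite codimension: the family separates points (intersection 0) and every
  compatible family of cosets comes from an element of A.\<close>
definition profinite_algebra :: "('k, 'm) ring_scheme \<Rightarrow> ('k, 'a, 'n) module_scheme \<Rightarrow> bool" where
  "profinite_algebra K A \<longleftrightarrow> k_algebra K A \<and>
     (\<exists>\<I>. \<I> \<noteq> {} \<and>
        (\<forall>I\<in>\<I>. ideal I A \<and> fin_codim K A I) \<and>
        (\<forall>I\<in>\<I>. \<forall>J\<in>\<I>. \<exists>L\<in>\<I>. L \<subseteq> I \<inter> J) \<and>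
        (\<Inter>\<I> = {\<zero>\<^bsub>A\<^esub>}) \<and>
        (\<forall>x. (\<forall>I\<in>\<I>. x I \<in> carrier A) \<and>
             (\<forall>I\<in>\<I>. \<forall>J\<in>\<I>. I \<subseteq> J \<longrightarrow> x I \<ominus>\<^bsub>A\<^esub> x J \<in> J)
           \<longrightarrow> (\<exists>y\<in>carrier A. \<forall>I\<in>\<I>. y \<ominus>\<^bsub>A\<^esub> x I \<in> I)))"

definition left_ideal :: "('a, 'n) ring_scheme \<Rightarrow> 'a set \<Rightarrow> bool" where
  "left_ideal A I \<longleftrightarrow> additive_subgroup I A \<and>
     (\<forall>r\<in>carrier A. \<forall>x\<in>I. r \<otimes>\<^bsub>A\<^esub> x \<in> I)"

text \<open>Left semiartinian: every nonzero cyclic left module A/I (I a proper left ideal)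
  has a nonzero socle, i.e. a simple submodule J/I with I strictly contained in J.\<close>
definition left_semiartinian :: "('a, 'n) ring_scheme \<Rightarrow> bool" where
  "left_semiartinian A \<longleftrightarrow> (\<forall>I. left_ideal A I \<and> I \<noteq> carrier A \<longrightarrow>
     (\<exists>J. left_ideal A J \<and> I \<subset> J \<and>
        (\<forall>L. left_ideal A L \<and> I \<subseteq> L \<and> L \<subseteq> J \<longrightarrow> L = I \<or> L = J)))"

text \<open>Left selfinjective: A is injective as a left A-module (stated via Baer's criterion):
  every left A-linear map from a left ideal into A is right multiplication by an element.\<close>
definition left_selfinjective :: "('a, 'n) ring_scheme \<Rightarrow> bool" where
  "left_selfinjective A \<longleftrightarrow> (\<forall>I f. left_ideal A I \<and> f \<in> I \<rightarrow> carrier A \<and>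
     (\<forall>x\<in>I. \<forall>y\<in>I. f (x \<oplus>\<^bsub>A\<^esub> y) = f x \<oplus>\<^bsub>A\<^esub> f y) \<and>
     (\<forall>r\<in>carrier A. \<forall>x\<in>I. f (r \<otimes>\<^bsub>A\<^esub> x) = r \<otimes>\<^bsub>A\<^esub> f x)
     \<longrightarrow> (\<exists>a\<in>carrier A. \<forall>x\<in>I. f x = x \<otimes>\<^bsub>A\<^esub> a))"

definition left_artinian :: "('a, 'n) ring_scheme \<Rightarrow> bool" where
  "left_artinian A \<longleftrightarrow> (\<forall>I :: nat \<Rightarrow> 'a set. (\<forall>n. left_ideal A (I n) \<and> I (Suc n) \<subseteq> I n)
     \<longrightarrow> (\<exists>N. \<forall>n\<ge>N. I n = I N))"

definition quasi_frobenius :: "('a, 'n) ring_scheme \<Rightarrow> bool" where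
  "quasi_frobenius A \<longleftrightarrow> left_selfinjective A \<and> left_artinian A"

end

theory Submission
  imports Defs
begin

text \<open>The left socle \<open>Soc A\<close> has finite length. Otherwise the elements \<open>a\<close> for which \<open>Soc A \<cdot> a\<close> has
  finite length form a proper left ideal \<open>K\<close>; selfinjectivity provides enough projections of the
  socle, realised as right multiplications, to show that \<open>A / K\<close> has no simple submodule, contrary
  to semiartinianness. Now the ideals of the family defining the topology intersect in \<open>0\<close>, so by
  directedness one of them meets \<open>Soc A\<close> trivially. As every nonzero left ideal contains a simple
  one, this ideal is \<open>0\<close>; being of finite codimension, it makes \<open>A\<close> finite dimensional.\<close>

text \<open>Right multiplication by an element maps the socle into itself, and by selfinjectivity
  every left linear endomorphism of the socle arises in this way. So \<open>K\<close> plays the role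
  of the operators of finite rank, and \<open>A / K\<close> has no simple submodule for the same
  reason that the power set of the natural numbers modulo finite sets has no atoms: an infinite set
  splits into two infinite halves. The obstacle is that no decomposition of the socle is at hand. An
  infinite sequence of simple left ideals is therefore built by hand, and length is never counted:
  it is handled by induction on simple summands and by the finiteness of chains of
  submodules.\<close>

no_notation Sum_Type.Plus (infixr \<open><+>\<close> 65)

section \<open>Additive subgroups stable under left multiplication\<close>

context ring
begin

text \<open>The acting set is a parameter so that one notion of length serves twice: over the whole
  ring for the socle, over the scalar multiples of \<open>\<one>\<close> for the dimension.\<close>

definition stable :: "'a set \<Rightarrow> 'a set \<Rightarrow> bool" where
  "stable B V \<longleftrightarrow> additive_subgroup V R \<and> (\<forall>b\<in>B. \<forall>x\<in>V. b \<otimes> x \<in> V)"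

lemma left_ideal_iff_stable: "left_ideal R V \<longleftrightarrow> stable (carrier R) V"
  by (simp add: left_ideal_def stable_def)

lemma stable_mono: "stable B V \<Longrightarrow> B' \<subseteq> B \<Longrightarrow> stable B' V"
  by (auto simp: stable_def)

lemma stableD:
  assumes "stable B V"
  shows "\<And>x. x \<in> V \<Longrightarrow> x \<in> carrier R" "\<zero> \<in> V"
    "\<And>x y. x \<in> V \<Longrightarrow> y \<in> V \<Longrightarrow> x \<oplus> y \<in> V"
    "\<And>x. x \<in> V \<Longrightarrow> \<ominus> x \<in> V"
    "\<And>x y. x \<in> V \<Longrightarrow> y \<in> V \<Longrightarrow> x \<ominus> y \<in> V"
    "\<And>b x. b \<in> B \<Longrightarrow> x \<in> V \<Longrightarrow> b \<otimes> x \<in> V"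
proof -
  interpret additive_subgroup V R
    using assms by (simp add: stable_def)
  show c: "\<And>x. x \<in> V \<Longrightarrow> x \<in> carrier R" by simp
  show "\<zero> \<in> V" by simp
  show p: "\<And>x y. x \<in> V \<Longrightarrow> y \<in> V \<Longrightarrow> x \<oplus> y \<in> V" by simp
  show m: "\<And>x. x \<in> V \<Longrightarrow> \<ominus> x \<in> V"
    by simp
  show "\<And>x y. x \<in> V \<Longrightarrow> y \<in> V \<Longrightarrow> x \<ominus> y \<in> V"
    using p m by (simp add: a_minus_def)
  show "\<And>b x. b \<in> B \<Longrightarrow> x \<in> V \<Longrightarrow> b \<otimes> x \<in> V"
    using assms by (simp add: stable_def)
qed

lemma stableI:
  assumes "V \<subseteq> carrier R" "\<zero> \<in> V"
    "\<And>x y. x \<in> V \<Longrightarrow> y \<in> V \<Longrightarrow> x \<oplus> y \<in> V"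
    "\<And>x. x \<in> V \<Longrightarrow> \<ominus> x \<in> V"
    "\<And>b x. b \<in> B \<Longrightarrow> x \<in> V \<Longrightarrow> b \<otimes> x \<in> V"
  shows "stable B V"
proof -
  have "subgroup V (add_monoid R)"
    using assms by (intro add.subgroupI) (auto simp: a_inv_def)
  then show ?thesis
    using assms by (auto simp: stable_def intro: additive_subgroupI)
qed

text \<open>For stability under all of \<open>R\<close>, negation is multiplication by \<open>\<ominus> \<one>\<close>.\<close>
lemma left_idealI:
  assumes "V \<subseteq> carrier R" "\<zero> \<in> V"
    "\<And>x y. x \<in> V \<Longrightarrow> y \<in> V \<Longrightarrow> x \<oplus> y \<in> V"
    "\<And>b x. b \<in> carrier R \<Longrightarrow> x \<in> V \<Longrightarrow> b \<otimes> x \<in> V"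
  shows "stable (carrier R) V"
proof (rule stableI)
  fix x assume "x \<in> V"
  then show "\<ominus> x \<in> V"
    using assms(4)[of "\<ominus> \<one>" x] assms(1) by (auto simp: l_minus)
qed (use assms in auto)

lemma minus_eq_zero_iff:
  assumes "x \<in> carrier R" "y \<in> carrier R"
  shows "x \<ominus> y = \<zero> \<longleftrightarrow> x = y"
proof
  assume "x \<ominus> y = \<zero>"
  moreover have "x = (x \<ominus> y) \<oplus> y"
    using assms by (simp add: a_minus_def a_assoc l_neg)
  ultimately show "x = y" using assms by simp
qed (use assms in \<open>simp add: a_minus_def r_neg\<close>)

lemma mem_set_add: "x \<in> V <+> W \<longleftrightarrow> (\<exists>v\<in>V. \<exists>w\<in>W. x = v \<oplus> w)"
  by (auto simp: set_add_def')

lemma stable_zero: "B \<subseteq> carrier R \<Longrightarrow> stable B {\<zero>}"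
  by (rule stableI) auto

lemma stable_set_add:
  assumes "B \<subseteq> carrier R" "stable B V" "stable B W"
  shows "stable B (V <+> W)"
  unfolding stable_def
proof (intro conjI ballI)
  show "additive_subgroup (V <+> W) R"
    using assms by (simp add: add_additive_subgroups stable_def)
  fix b x assume b: "b \<in> B" and "x \<in> V <+> W"
  then obtain v w where vw: "v \<in> V" "w \<in> W" "x = v \<oplus> w"
    by (auto simp: mem_set_add)
  then have "b \<otimes> x = b \<otimes> v \<oplus> b \<otimes> w"
    using b assms(1) stableD(1)[OF assms(2)] stableD(1)[OF assms(3)] by (auto simp: r_distr)
  then show "b \<otimes> x \<in> V <+> W"
    unfolding mem_set_add using vw b stableD(6)[OF assms(2)] stableD(6)[OF assms(3)] by blast
qed

lemma set_add_upper1: "V \<subseteq> carrier R \<Longrightarrow> stable B W \<Longrightarrow> V \<subseteq> V <+> W"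
  using stableD(2)[of B W] by (force simp: mem_set_add)

lemma set_add_upper2: "stable B V \<Longrightarrow> W \<subseteq> carrier R \<Longrightarrow> W \<subseteq> V <+> W"
  using stableD(2)[of B V] by (force simp: mem_set_add)

lemma set_add_mono: "V \<subseteq> V' \<Longrightarrow> W \<subseteq> W' \<Longrightarrow> V <+> W \<subseteq> V' <+> W'"
  unfolding set_add_def' by blast

lemma stable_Int: "stable B V \<Longrightarrow> stable B W \<Longrightarrow> stable B (V \<inter> W)"
  by (rule stableI) (auto dest: stableD)

lemma stable_image_mult_right:
  assumes "stable (carrier R) V" "a \<in> carrier R"
  shows "stable (carrier R) ((\<lambda>x. x \<otimes> a) ` V)"
proof (rule left_idealI)
  show "\<zero> \<in> (\<lambda>x. x \<otimes> a) ` V"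
    using stableD(2)[OF assms(1)] assms(2) by (force intro: image_eqI[of _ _ "\<zero>"])
  show "x \<oplus> y \<in> (\<lambda>x. x \<otimes> a) ` V" if "x \<in> (\<lambda>x. x \<otimes> a) ` V" "y \<in> (\<lambda>x. x \<otimes> a) ` V" for x y
    using that stableD(1,3)[OF assms(1)] assms(2) by (auto simp: l_distr[symmetric])
  show "b \<otimes> x \<in> (\<lambda>x. x \<otimes> a) ` V" if "b \<in> carrier R" "x \<in> (\<lambda>x. x \<otimes> a) ` V" for b x
    using that stableD(1,6)[OF assms(1)] assms(2) by (auto simp: m_assoc[symmetric])
qed (use stableD(1)[OF assms(1)] assms(2) in auto)

lemma stable_vimage_mult_right:
  assumes "stable (carrier R) V" "a \<in> carrier R"
  shows "stable (carrier R) {x \<in> carrier R. x \<otimes> a \<in> V}"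
  using assms by (intro left_idealI) (auto simp: l_distr m_assoc dest: stableD)

lemma stable_principal:
  assumes "a \<in> carrier R"
  shows "stable (carrier R) {r \<otimes> a |r. r \<in> carrier R}"
proof -
  have "stable (carrier R) (carrier R)"
    by (rule left_idealI) auto
  from stable_image_mult_right[OF this assms] show ?thesis
    by (simp add: image_def Bex_def conj_commute)
qed

text \<open>Serves both Zorn's lemma and infinite sums, which are unions of their
  truncations.\<close>

lemma stable_Union_chain:
  assumes "\<C> \<noteq> {}" "\<And>V. V \<in> \<C> \<Longrightarrow> stable B V"
    and chain: "\<And>V W. V \<in> \<C> \<Longrightarrow> W \<in> \<C> \<Longrightarrow> V \<subseteq> W \<or> W \<subseteq> V"
  shows "stable B (\<Union>\<C>)"
proof (rule stableI)
  show "x \<oplus> y \<in> \<Union>\<C>" if "x \<in> \<Union>\<C>" "y \<in> \<Union>\<C>" for x y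
  proof -
    from that obtain V W where "V \<in> \<C>" "W \<in> \<C>" "x \<in> V" "y \<in> W" by blast
    moreover from this chain obtain U where "U \<in> \<C>" "x \<in> U" "y \<in> U" by blast
    ultimately show ?thesis using stableD(3) assms(2) by blast
  qed
qed (use assms(1,2) in \<open>auto dest: stableD\<close>)

section \<open>Simple submodules and finite length\<close>

text \<open>The zero submodule counts as simple, so that images of simple submodules are simple.\<close>
definition simple_sub :: "'a set \<Rightarrow> 'a set \<Rightarrow> bool" where
  "simple_sub B S \<longleftrightarrow> stable B S \<and> (\<forall>s\<in>S. s \<noteq> \<zero> \<longrightarrow> (\<forall>t\<in>S. \<exists>r\<in>B. t = r \<otimes> s))"

lemma simple_sub_stable: "simple_sub B S \<Longrightarrow> stable B S"
  by (simp add: simple_sub_def)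

text \<open>If \<open>s \<otimes> a\<close> is nonzero then so is \<open>s\<close>, which therefore
  generates \<open>S\<close>; by associativity \<open>s \<otimes> a\<close> generates the
  image.\<close>

lemma simple_sub_image:
  assumes "simple_sub (carrier R) S" "a \<in> carrier R"
  shows "simple_sub (carrier R) ((\<lambda>x. x \<otimes> a) ` S)"
  unfolding simple_sub_def
proof (intro conjI ballI impI)
  have S: "stable (carrier R) S" using assms by (simp add: simple_sub_def)
  then show "stable (carrier R) ((\<lambda>x. x \<otimes> a) ` S)"
    using assms(2) by (rule stable_image_mult_right)
  fix x y assume x: "x \<in> (\<lambda>x. x \<otimes> a) ` S" "x \<noteq> \<zero>" and y: "y \<in> (\<lambda>x. x \<otimes> a) ` S"
  obtain s t where st: "s \<in> S" "x = s \<otimes> a" "t \<in> S" "y = t \<otimes> a" using x y by auto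
  then have "s \<noteq> \<zero>" using x assms(2) by auto
  then obtain r where "r \<in> carrier R" "t = r \<otimes> s"
    using st assms(1) unfolding simple_sub_def by blast
  then show "\<exists>r\<in>carrier R. y = r \<otimes> x"
    using st stableD(1)[OF S] assms(2) by (auto simp: m_assoc)
qed

text \<open>Only semisimple submodules arise this way. For \<open>B = carrier R\<close> they are left ideals; for
  \<open>B = K \<cdot> 1\<close> in a \<open>K\<close>-algebra they are the finite dimensional subspaces.\<close>
inductive fin_len :: "'a set \<Rightarrow> 'a set \<Rightarrow> bool" for B where
  zero: "fin_len B {\<zero>}"
| add: "fin_len B V \<Longrightarrow> simple_sub B S \<Longrightarrow> fin_len B (V <+> S)"

lemma fin_len_stable: "fin_len B V \<Longrightarrow> B \<subseteq> carrier R \<Longrightarrow> stable B V"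
  by (induction rule: fin_len.induct) (auto simp: simple_sub_def stable_zero stable_set_add)

lemma set_add_zero: "V \<subseteq> carrier R \<Longrightarrow> V <+> {\<zero>} = V"
  by (force simp: mem_set_add)

lemma set_add_assoc:
  assumes "U \<subseteq> carrier R" "V \<subseteq> carrier R" "W \<subseteq> carrier R"
  shows "U <+> V <+> W = U <+> (V <+> W)"
  using assms add.set_mult_assoc by (simp add: set_add_def)

lemma fin_len_set_add:
  assumes "fin_len B W" "fin_len B V" "B \<subseteq> carrier R"
  shows "fin_len B (V <+> W)"
  using assms(1)
proof induction
  case zero
  then show ?case
    using assms fin_len_stable[THEN stableD(1)] by (subst set_add_zero) auto
next
  case (add W S)
  have "V <+> (W <+> S) = V <+> W <+> S"
    using add assms fin_len_stable[THEN stableD(1)] stableD(1)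
    by (intro set_add_assoc[symmetric]) (auto simp: simple_sub_def)
  then show ?case
    using add by (auto intro: fin_len.add)
qed

lemma fin_len_image:
  assumes "fin_len (carrier R) V" "a \<in> carrier R"
  shows "fin_len (carrier R) ((\<lambda>x. x \<otimes> a) ` V)"
  using assms(1)
proof induction
  case zero
  then show ?case using assms(2) by (simp add: fin_len.zero)
next
  case (add V S)
  have cV: "V \<subseteq> carrier R" and cS: "S \<subseteq> carrier R"
    using add fin_len_stable[THEN stableD(1)] stableD(1) by (auto simp: simple_sub_def)
  have "(\<lambda>x. x \<otimes> a) ` (V <+> S) = (\<lambda>x. x \<otimes> a) ` V <+> (\<lambda>x. x \<otimes> a) ` S"
    (is "?L = ?R")
  proof
    show "?L \<subseteq> ?R"
      using cV cS assms(2) by (fastforce simp: mem_set_add l_distr subset_iff)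
    show "?R \<subseteq> ?L"
    proof
      fix x assume "x \<in> ?R"
      then obtain v s where "v \<in> V" "s \<in> S" "x = v \<otimes> a \<oplus> s \<otimes> a"
        by (auto simp: mem_set_add)
      moreover from this have "x = (v \<oplus> s) \<otimes> a"
        using cV cS assms(2) by (auto simp: l_distr subset_iff)
      ultimately show "x \<in> ?L" unfolding image_iff Bex_def mem_set_add by blast
    qed
  qed
  then show ?case
    using add assms(2) by (auto intro: fin_len.add simple_sub_image)
qed

text \<open>A member of the chain is determined by its trace on \<open>V\<close> and by whether it is contained
  in \<open>V\<close>: by simplicity of \<open>S\<close>, an element outside \<open>V\<close> generates all of \<open>V <+> S\<close> modulo \<open>V\<close>.\<close>
lemma fin_len_chain_finite:
  assumes "fin_len B V" "B \<subseteq> carrier R"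
    and "\<And>X. X \<in> \<C> \<Longrightarrow> stable B X \<and> X \<subseteq> V"
    and "\<And>X Y. X \<in> \<C> \<Longrightarrow> Y \<in> \<C> \<Longrightarrow> X \<subseteq> Y \<or> Y \<subseteq> X"
  shows "finite \<C>"
  using assms(1,3,4)
proof (induction arbitrary: \<C>)
  case zero
  then have "\<C> \<subseteq> Pow {\<zero>}" by auto
  then show ?case by (rule finite_subset) simp
next
  case (add V S)
  have V: "stable B V" using add.hyps(1) assms(2) by (rule fin_len_stable)
  have S: "stable B S" using add.hyps(2) by (simp add: simple_sub_def)
  have key: "Y \<subseteq> X"
    if X: "X \<in> \<C>" and Y: "Y \<in> \<C>" and XY: "X \<subseteq> Y" and tr: "X \<inter> V = Y \<inter> V"
      and sub: "X \<subseteq> V \<longleftrightarrow> Y \<subseteq> V" for X Y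
  proof (cases "Y \<subseteq> V")
    case True
    then show ?thesis using tr by auto
  next
    case False
    have sX: "stable B X" "X \<subseteq> V <+> S" and sY: "stable B Y" "Y \<subseteq> V <+> S"
      using add.prems(1) X Y by auto
    obtain x where x: "x \<in> X" "x \<notin> V" using False sub by auto
    then obtain v s where vs: "v \<in> V" "s \<in> S" "x = v \<oplus> s"
      using sX(2) unfolding subset_iff mem_set_add by blast
    have s0: "s \<noteq> \<zero>" using x vs stableD(1)[OF V] by auto
    show ?thesis
    proof
      fix y assume y: "y \<in> Y"
      then obtain v' s' where vs': "v' \<in> V" "s' \<in> S" "y = v' \<oplus> s'"
        using sY(2) unfolding subset_iff mem_set_add by blast
      obtain r where r: "r \<in> B" "s' = r \<otimes> s"
        using add.hyps vs' vs s0 unfolding simple_sub_def by blast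
      have c: "v \<in> carrier R" "s \<in> carrier R" "v' \<in> carrier R" "r \<in> carrier R"
        using vs vs' r assms(2) stableD(1)[OF V] stableD(1)[OF S] by auto
      \<comment> \<open>The factor \<open>r\<close> was chosen so that the components in
        \<open>S\<close> cancel.\<close>
      have "y \<ominus> r \<otimes> x = v' \<ominus> r \<otimes> v"
        unfolding vs vs' r using c
        by (simp add: a_minus_def minus_add r_distr r_minus a_ac r_neg1 r_neg2)
      also have "\<dots> \<in> V" using vs(1) vs'(1) r(1) stableD(5,6)[OF V] by blast
      finally have "y \<ominus> r \<otimes> x \<in> V" .
      moreover have rx: "r \<otimes> x \<in> X" using r x stableD(6)[OF sX(1)] by blast
      \<comment> \<open>The difference lies in \<open>Y \<inter> V\<close>, which equals
        \<open>X \<inter> V\<close>.\<close>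
      ultimately have "y \<ominus> r \<otimes> x \<in> X"
        using tr stableD(5)[OF sY(1) y, of "r \<otimes> x"] XY by blast
      then have "(y \<ominus> r \<otimes> x) \<oplus> r \<otimes> x \<in> X"
        using rx stableD(3)[OF sX(1)] by blast
      moreover have "(y \<ominus> r \<otimes> x) \<oplus> r \<otimes> x = y"
        using stableD(1)[OF sX(1) rx] stableD(1)[OF sY(1) y]
        by (simp add: a_minus_def a_assoc l_neg)
      ultimately show "y \<in> X" by simp
    qed
  qed
  have "finite ((\<lambda>X. X \<inter> V) ` \<C>)"
  proof (rule add.IH)
    fix X assume "X \<in> (\<lambda>X. X \<inter> V) ` \<C>"
    then show "stable B X \<and> X \<subseteq> V" using add.prems(1) V stable_Int by auto
  next
    fix X Y assume "X \<in> (\<lambda>X. X \<inter> V) ` \<C>" "Y \<in> (\<lambda>X. X \<inter> V) ` \<C>"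
    then show "X \<subseteq> Y \<or> Y \<subseteq> X" using add.prems(2) by fast
  qed
  moreover have "(\<lambda>X. (X \<inter> V, X \<subseteq> V)) ` \<C> \<subseteq> ((\<lambda>X. X \<inter> V) ` \<C>) \<times> UNIV"
    by auto
  ultimately have "finite ((\<lambda>X. (X \<inter> V, X \<subseteq> V)) ` \<C>)"
    by (meson finite_SigmaI finite_UNIV finite_subset)
  moreover have "inj_on (\<lambda>X. (X \<inter> V, X \<subseteq> V)) \<C>"
  proof (rule inj_onI)
    fix X Y assume XY: "X \<in> \<C>" "Y \<in> \<C>" "(X \<inter> V, X \<subseteq> V) = (Y \<inter> V, Y \<subseteq> V)"
    then have tr: "X \<inter> V = Y \<inter> V" "X \<subseteq> V \<longleftrightarrow> Y \<subseteq> V" by simp_all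
    from add.prems(2)[OF XY(1,2)] show "X = Y"
    proof
      assume "X \<subseteq> Y"
      from this key[OF XY(1,2) this tr] show ?thesis by (rule subset_antisym)
    next
      assume "Y \<subseteq> X"
      from key[OF XY(2,1) this tr(1)[symmetric] tr(2)[symmetric]] this
      show ?thesis by (rule subset_antisym)
    qed
  qed
  ultimately show ?case by (rule finite_imageD)
qed

section \<open>The socle\<close>

text \<open>This is the sum of all simple left ideals. As an intersection it needs no infinite sums,
  and an inclusion of the socle in a left ideal has to be checked on simple left ideals
  only.\<close>

definition socle :: "'a set" where
  "socle = \<Inter>{V. stable (carrier R) V \<and> (\<forall>S. simple_sub (carrier R) S \<longrightarrow> S \<subseteq> V)}"

lemma socle_least:
  assumes "stable (carrier R) V" "\<And>S. simple_sub (carrier R) S \<Longrightarrow> S \<subseteq> V"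
  shows "socle \<subseteq> V"
  using assms unfolding socle_def by blast

lemma simple_sub_subset_socle: "simple_sub (carrier R) S \<Longrightarrow> S \<subseteq> socle"
  unfolding socle_def by blast

lemma socle_subset_carrier: "socle \<subseteq> carrier R"
  by (rule socle_least) (auto simp: simple_sub_def intro: left_idealI dest: stableD(1))

lemma stable_socle: "stable (carrier R) socle"
proof (rule left_idealI)
  show "socle \<subseteq> carrier R" by (rule socle_subset_carrier)
qed (auto simp: socle_def dest: stableD)

text \<open>The elements that \<open>b\<close> multiplies into the socle form a left ideal, and it
  contains every simple \<open>S\<close> because the image of \<open>S\<close> is simple again. So
  the socle is a two-sided ideal.\<close>

lemma socle_mult_right:
  assumes "s \<in> socle" "b \<in> carrier R"
  shows "s \<otimes> b \<in> socle"
proof -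
  have "socle \<subseteq> {x \<in> carrier R. x \<otimes> b \<in> socle}"
  proof (rule socle_least)
    show "stable (carrier R) {x \<in> carrier R. x \<otimes> b \<in> socle}"
      using stable_socle assms(2) by (rule stable_vimage_mult_right)
    fix S assume S: "simple_sub (carrier R) S"
    then have "(\<lambda>x. x \<otimes> b) ` S \<subseteq> socle"
      using assms(2) by (intro simple_sub_subset_socle simple_sub_image)
    then show "S \<subseteq> {x \<in> carrier R. x \<otimes> b \<in> socle}"
      using S stableD(1) by (auto simp: simple_sub_def)
  qed
  then show ?thesis using assms by auto
qed

lemma stable_left_annihilator:
  assumes "x \<in> carrier R"
  shows "stable (carrier R) {r \<in> carrier R. r \<otimes> x = \<zero>}"
  using stable_vimage_mult_right[OF stable_zero[OF subset_refl] assms] by simp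

text \<open>The hypothesis speaks of quotients of the ring, the conclusion of submodules. For
  nonzero \<open>x\<close> in \<open>L\<close>, the left ideal generated by \<open>x\<close> is the
  quotient by the annihilator \<open>N\<close> of \<open>x\<close>, and a simple
  \<open>J / N\<close> becomes the simple left ideal of all \<open>j \<otimes> x\<close>.\<close>

lemma semiartinian_simple_sub:
  assumes "left_semiartinian R" and L: "stable (carrier R) L" "L \<noteq> {\<zero>}"
  obtains S s where "simple_sub (carrier R) S" "S \<subseteq> L" "s \<in> S" "s \<noteq> \<zero>"
proof -
  obtain x where x: "x \<in> L" "x \<noteq> \<zero>" "x \<in> carrier R"
    using L stableD(1,2)[OF L(1)] by blast
  define N where "N = {r \<in> carrier R. r \<otimes> x = \<zero>}"
  have N: "stable (carrier R) N"
    unfolding N_def using x(3) by (rule stable_left_annihilator)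
  have "\<one> \<notin> N" using x by (simp add: N_def)
  then have "N \<noteq> carrier R" by auto
  then obtain J where J: "stable (carrier R) J" "N \<subset> J"
    and min: "\<And>L. stable (carrier R) L \<Longrightarrow> N \<subseteq> L \<Longrightarrow> L \<subseteq> J \<Longrightarrow> L = N \<or> L = J"
    using assms(1)[unfolded left_semiartinian_def left_ideal_iff_stable, rule_format, OF conjI, OF N]
    by meson
  have "simple_sub (carrier R) ((\<lambda>j. j \<otimes> x) ` J)"
    unfolding simple_sub_def
  proof (intro conjI ballI impI)
    show "stable (carrier R) ((\<lambda>j. j \<otimes> x) ` J)"
      using J(1) x(3) by (rule stable_image_mult_right)
    fix s t assume s: "s \<in> (\<lambda>j. j \<otimes> x) ` J" "s \<noteq> \<zero>" and t: "t \<in> (\<lambda>j. j \<otimes> x) ` J"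
    obtain j where j: "j \<in> J" "s = j \<otimes> x" using s by auto
    obtain i where i: "i \<in> J" "t = i \<otimes> x" using t by auto
    have c: "i \<in> carrier R" "j \<in> carrier R" using i j J stableD(1) by blast+
    \<comment> \<open>Since \<open>j\<close> is not in \<open>N\<close>, minimality forces this left
      ideal to be \<open>J\<close>. Hence \<open>i\<close> is a multiple of \<open>j\<close> modulo
      \<open>N\<close>, and multiplication by \<open>x\<close> kills \<open>N\<close>.\<close>
    let ?L = "N <+> {r \<otimes> j |r. r \<in> carrier R}"
    have P: "stable (carrier R) {r \<otimes> j |r. r \<in> carrier R}"
      using c(2) by (rule stable_principal)
    have L: "stable (carrier R) ?L"
      by (rule stable_set_add[OF subset_refl N P])
    have 1: "N \<subseteq> ?L"
      using set_add_upper1[OF _ P] stableD(1)[OF N] by blast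
    have 2: "?L \<subseteq> J"
    proof
      fix y assume "y \<in> ?L"
      then obtain n r where "n \<in> N" "r \<in> carrier R" "y = n \<oplus> r \<otimes> j"
        unfolding mem_set_add by blast
      then show "y \<in> J" using J j stableD(3,6)[OF J(1)] by blast
    qed
    have "j \<in> ?L"
    proof -
      have "j = \<one> \<otimes> j" using c by simp
      then have "j \<in> {r \<otimes> j |r. r \<in> carrier R}" by blast
      then show ?thesis using set_add_upper2[OF N] stableD(1)[OF P] by blast
    qed
    moreover have "j \<notin> N" using j s by (simp add: N_def)
    ultimately have "?L = J" using min[OF L 1 2] by blast
    then obtain n r where nr: "n \<in> N" "r \<in> carrier R" "i = n \<oplus> r \<otimes> j"
      using i(1) unfolding set_eq_iff mem_set_add by blast
    then have "t = r \<otimes> s"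
      using i j x c by (auto simp: N_def l_distr m_assoc)
    then show "\<exists>r\<in>carrier R. t = r \<otimes> s" using nr by blast
  qed
  moreover have "(\<lambda>j. j \<otimes> x) ` J \<subseteq> L"
    using J stableD(1)[OF J(1)] stableD(6)[OF L(1)] x by auto
  moreover obtain j where "j \<in> J" "j \<notin> N" using J by blast
  then have "j \<otimes> x \<in> (\<lambda>j. j \<otimes> x) ` J" "j \<otimes> x \<noteq> \<zero>"
    using stableD(1)[OF J(1)] by (auto simp: N_def)
  ultimately show ?thesis using that by blast
qed

section \<open>Complements and projections\<close>

text \<open>Zorn's lemma gives \<open>W\<close> maximal among the left ideals above \<open>Z\<close>
  that meet \<open>U\<close> trivially. A simple \<open>S\<close> outside \<open>U <+> W\<close>
  would meet it trivially, so \<open>W <+> S\<close> would still meet \<open>U\<close> trivially,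
  against maximality.\<close>

lemma exists_complement:
  assumes U: "stable (carrier R) U" and Z: "stable (carrier R) Z" and "U \<inter> Z = {\<zero>}"
  obtains W where "stable (carrier R) W" "Z \<subseteq> W" "U \<inter> W = {\<zero>}" "socle \<subseteq> U <+> W"
proof -
  let ?A = "{W. stable (carrier R) W \<and> Z \<subseteq> W \<and> U \<inter> W = {\<zero>}}"
  have "\<exists>M\<in>?A. \<forall>X\<in>?A. M \<subseteq> X \<longrightarrow> X = M"
  proof (rule subset_Zorn_nonempty)
    show "?A \<noteq> {}" using assms by blast
    fix \<C> assume C: "\<C> \<noteq> {}" "subset.chain ?A \<C>"
    then have sub: "\<C> \<subseteq> ?A" and ch: "\<And>V W. V \<in> \<C> \<Longrightarrow> W \<in> \<C> \<Longrightarrow> V \<subseteq> W \<or> W \<subseteq> V"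
      by (auto simp: subset_chain_def)
    have "stable (carrier R) (\<Union>\<C>)"
      using C(1) sub ch by (intro stable_Union_chain) auto
    then show "\<Union>\<C> \<in> ?A" using C(1) sub by blast
  qed
  then obtain W where "W \<in> ?A" and max': "\<forall>X\<in>?A. W \<subseteq> X \<longrightarrow> X = W" ..
  then have W: "stable (carrier R) W" "Z \<subseteq> W" "U \<inter> W = {\<zero>}"
    and max: "\<And>X. stable (carrier R) X \<Longrightarrow> Z \<subseteq> X \<Longrightarrow> U \<inter> X = {\<zero>} \<Longrightarrow> W \<subseteq> X \<Longrightarrow> X = W"
    by auto
  have UW: "stable (carrier R) (U <+> W)"
    by (rule stable_set_add[OF subset_refl U W(1)])
  have W_UW: "W \<subseteq> U <+> W"
    using set_add_upper2[OF U] stableD(1)[OF W(1)] by blast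
  have "socle \<subseteq> U <+> W"
  proof (rule socle_least[OF UW], rule ccontr)
    fix S assume S: "simple_sub (carrier R) S" and nsub: "\<not> S \<subseteq> U <+> W"
    have sS: "stable (carrier R) S" using S by (simp add: simple_sub_def)
    have WS: "stable (carrier R) (W <+> S)"
      by (rule stable_set_add[OF subset_refl W(1) sS])
    have W_WS: "W \<subseteq> W <+> S" using set_add_upper1[OF _ sS] stableD(1)[OF W(1)] by blast
    have "U \<inter> (W <+> S) \<subseteq> {\<zero>}"
    proof
      fix u assume u: "u \<in> U \<inter> (W <+> S)"
      then obtain w s where ws: "w \<in> W" "s \<in> S" "u = w \<oplus> s" unfolding Int_iff mem_set_add by blast
      have c: "u \<in> carrier R" "w \<in> carrier R" "s \<in> carrier R"
        using u ws stableD(1)[OF U] stableD(1)[OF W(1)] stableD(1)[OF sS] by auto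
      have "s = u \<oplus> \<ominus> w" using ws c by (simp add: a_ac r_neg)
      then have sUW: "s \<in> U <+> W"
        using u ws stableD(4)[OF W(1)] unfolding mem_set_add by blast
      have "s = \<zero>"
      proof (rule ccontr)
        assume s0: "s \<noteq> \<zero>"
        have "S \<subseteq> U <+> W"
        proof
          fix t assume "t \<in> S"
          then obtain r where "r \<in> carrier R" "t = r \<otimes> s"
            using S s0 ws unfolding simple_sub_def by blast
          then show "t \<in> U <+> W" using sUW stableD(6)[OF UW] by blast
        qed
        then show False using nsub by blast
      qed
      then have "u \<in> W" using ws c by simp
      then show "u \<in> {\<zero>}" using u W(3) by blast
    qed
    then have "U \<inter> (W <+> S) = {\<zero>}" using stableD(2)[OF U] stableD(2)[OF WS] by blast
    then have "W <+> S = W" using max[OF WS] W(2) W_WS by blast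
    then have "S \<subseteq> W" using set_add_upper2[OF W(1), of S] stableD(1)[OF sS] by blast
    then show False using nsub W_UW by blast
  qed
  then show ?thesis using that W by blast
qed

text \<open>Components in a direct sum are unique, so the projection to \<open>U\<close> along
  \<open>W\<close> is a left linear map on a left ideal, and selfinjectivity turns it into a right
  multiplication.\<close>

lemma selfinjective_projection:
  assumes "left_selfinjective R"
    and U: "stable (carrier R) U" and W: "stable (carrier R) W" and int: "U \<inter> W = {\<zero>}"
  obtains r where "r \<in> carrier R" "\<And>u w. u \<in> U \<Longrightarrow> w \<in> W \<Longrightarrow> (u \<oplus> w) \<otimes> r = u"
proof -
  define f where "f x = (SOME u. u \<in> U \<and> (\<exists>w\<in>W. x = u \<oplus> w))" for x
  have f: "f (u \<oplus> w) = u" if uw: "u \<in> U" "w \<in> W" for u w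
    unfolding f_def
  proof (rule some_equality)
    show "u \<in> U \<and> (\<exists>w'\<in>W. u \<oplus> w = u \<oplus> w')" using uw by blast
    fix u' assume "u' \<in> U \<and> (\<exists>w'\<in>W. u \<oplus> w = u' \<oplus> w')"
    then obtain w' where u': "u' \<in> U" "w' \<in> W" "u \<oplus> w = u' \<oplus> w'" by blast
    have c: "u \<in> carrier R" "w \<in> carrier R" "u' \<in> carrier R" "w' \<in> carrier R"
      using uw u' stableD(1)[OF U] stableD(1)[OF W] by auto
    have "w = \<ominus> u \<oplus> (u \<oplus> w)" using c by (simp add: r_neg1)
    also have "\<dots> = (u' \<ominus> u) \<oplus> w'" using c by (simp add: u'(3) a_minus_def a_ac)
    finally have "w \<ominus> w' = u' \<ominus> u" using c by (simp add: a_minus_def a_assoc r_neg)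
    then have "u' \<ominus> u \<in> U \<inter> W"
      using stableD(5)[OF U u'(1) uw(1)] stableD(5)[OF W uw(2) u'(2)] by simp
    then have "u' \<ominus> u = \<zero>" using int by blast
    then show "u' = u" using c by (simp add: minus_eq_zero_iff)
  qed
  have "\<exists>a\<in>carrier R. \<forall>x\<in>U <+> W. f x = x \<otimes> a"
  proof -
    have "left_ideal R (U <+> W)"
      unfolding left_ideal_iff_stable by (rule stable_set_add[OF subset_refl U W])
    moreover have "f \<in> (U <+> W) \<rightarrow> carrier R"
      using f stableD(1)[OF U] by (auto simp: mem_set_add)
    moreover have "f (x \<oplus> y) = f x \<oplus> f y" if xy: "x \<in> U <+> W" "y \<in> U <+> W" for x y
    proof -
      obtain u w u' w' where e: "u \<in> U" "w \<in> W" "x = u \<oplus> w" "u' \<in> U" "w' \<in> W" "y = u' \<oplus> w'"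
        using xy unfolding mem_set_add by blast
      have c: "u \<in> carrier R" "w \<in> carrier R" "u' \<in> carrier R" "w' \<in> carrier R"
        using e stableD(1)[OF U] stableD(1)[OF W] by auto
      have "x \<oplus> y = (u \<oplus> u') \<oplus> (w \<oplus> w')" using c by (simp add: e a_ac)
      then show ?thesis
        using f[of "u \<oplus> u'" "w \<oplus> w'"] f e stableD(3)[OF U] stableD(3)[OF W] by simp
    qed
    moreover have "f (r \<otimes> x) = r \<otimes> f x" if r: "r \<in> carrier R" and x: "x \<in> U <+> W" for r x
    proof -
      obtain u w where e: "u \<in> U" "w \<in> W" "x = u \<oplus> w"
        using x unfolding mem_set_add by blast
      have "r \<otimes> x = r \<otimes> u \<oplus> r \<otimes> w"
        using r e stableD(1)[OF U] stableD(1)[OF W] by (auto simp: r_distr)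
      then show ?thesis
        using f[of "r \<otimes> u" "r \<otimes> w"] f e r stableD(6)[OF U] stableD(6)[OF W] by simp
    qed
    ultimately show ?thesis
      by (intro mp[OF spec[OF spec[OF assms(1)[unfolded left_selfinjective_def]]]]) blast
  qed
  then obtain r where r: "r \<in> carrier R" "\<And>x. x \<in> U <+> W \<Longrightarrow> f x = x \<otimes> r" by blast
  show ?thesis
  proof (rule that[OF r(1)])
    fix u w assume "u \<in> U" "w \<in> W"
    then show "(u \<oplus> w) \<otimes> r = u" using f r(2)[of "u \<oplus> w"] unfolding mem_set_add by metis
  qed
qed

section \<open>Independent sequences of simple left ideals\<close>

text \<open>Truncations of the sum of the \<open>S i\<close> selected by \<open>P\<close>; the full
  sum is their union. The selection is a parameter because complementary halves of one sequence are
  compared.\<close>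

primrec part :: "(nat \<Rightarrow> bool) \<Rightarrow> (nat \<Rightarrow> 'a set) \<Rightarrow> nat \<Rightarrow> 'a set" where
  "part P S 0 = {\<zero>}"
| "part P S (Suc n) = (if P n then part P S n <+> S n else part P S n)"

text \<open>As \<open>\<zero>\<close> lies in every truncation, the last condition also makes
  multiplication by \<open>a\<close> injective on \<open>S n\<close>. The images of the
  \<open>S n\<close> thus form a direct sum of nonzero simple left ideals.\<close>

definition indep :: "'a \<Rightarrow> (nat \<Rightarrow> 'a set) \<Rightarrow> bool" where
  "indep a S \<longleftrightarrow> (\<forall>n. simple_sub (carrier R) (S n) \<and> (\<exists>s\<in>S n. s \<noteq> \<zero>) \<and>
     (\<forall>s\<in>S n. s \<otimes> a \<in> (\<lambda>x. x \<otimes> a) ` part (\<lambda>_. True) S n \<longrightarrow> s = \<zero>))"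

lemma stable_part:
  assumes "\<And>n. simple_sub (carrier R) (S n)"
  shows "stable (carrier R) (part P S n)"
  using assms by (induction n) (auto simp: simple_sub_def stable_zero stable_set_add)

lemma part_subset_Suc:
  assumes "\<And>n. simple_sub (carrier R) (S n)"
  shows "part P S n \<subseteq> part P S (Suc n)"
proof (cases "P n")
  case True
  have "stable (carrier R) (S n)" using assms by (simp add: simple_sub_def)
  then show ?thesis
    using True set_add_upper1 stableD(1)[OF stable_part[OF assms]] by (simp add: subset_iff)
qed simp

lemma part_mono:
  assumes "\<And>n. simple_sub (carrier R) (S n)" "m \<le> n"
  shows "part P S m \<subseteq> part P S n"
  by (rule lift_Suc_mono_le[of "part P S", OF part_subset_Suc[OF assms(1)] assms(2)])

lemma part_subset_part:
  assumes "\<And>n. simple_sub (carrier R) (S n)" "\<And>n. P n \<Longrightarrow> Q n"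
  shows "part P S n \<subseteq> part Q S n"
proof (induction n)
  case (Suc n)
  show ?case
  proof (cases "P n")
    case True
    then show ?thesis
      using Suc assms(2) by (simp add: set_add_mono)
  next
    case False
    then have "part P S (Suc n) \<subseteq> part Q S n" using Suc by simp
    then show ?thesis using part_subset_Suc[of S Q n, OF assms(1)] by blast
  qed
qed simp

lemma stable_Union_part:
  assumes "\<And>n. simple_sub (carrier R) (S n)"
  shows "stable (carrier R) (\<Union>n. part P S n)"
proof (rule stable_Union_chain)
  fix V W assume "V \<in> range (part P S)" "W \<in> range (part P S)"
  then obtain m n where "V = part P S m" "W = part P S n" by blast
  then show "V \<subseteq> W \<or> W \<subseteq> V"
    using part_mono[of S m n P, OF assms] part_mono[of S n m P, OF assms] nat_le_linear[of m n]
    by auto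
qed (use stable_part[of S P, OF assms] in auto)

text \<open>The last member \<open>S n\<close> belongs to exactly one of the two selections. Moving
  all other terms to the other side puts the image of its component \<open>s\<close> into the image
  of the earlier members, so \<open>s\<close> vanishes and the induction hypothesis applies.\<close>

lemma indep_part:
  assumes "indep a S" "a \<in> carrier R"
  shows "\<And>u w P. u \<in> part P S n \<Longrightarrow> w \<in> part (\<lambda>n. \<not> P n) S n \<Longrightarrow> u \<otimes> a = w \<otimes> a
    \<Longrightarrow> u = \<zero> \<and> w = \<zero>"
proof (induction n)
  case 0
  then show ?case by simp
next
  case (Suc n)
  have simple: "\<And>n. simple_sub (carrier R) (S n)" using assms by (simp add: indep_def)
  have st: "\<And>P n. stable (carrier R) (part P S n)" using simple by (rule stable_part)
  have step: "u = \<zero> \<and> w = \<zero>"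
    if P: "P n" and u: "u \<in> part P S (Suc n)" and w: "w \<in> part (\<lambda>n. \<not> P n) S (Suc n)"
      and eq: "u \<otimes> a = w \<otimes> a" for P u w
  proof -
    obtain u' s where us: "u' \<in> part P S n" "s \<in> S n" "u = u' \<oplus> s"
      using u P by (auto simp: mem_set_add)
    have w': "w \<in> part (\<lambda>n. \<not> P n) S n" using w P by simp
    have "S n \<subseteq> carrier R"
      using simple_sub_stable[OF simple] stableD(1) by blast
    then have c: "u' \<in> carrier R" "s \<in> carrier R" "w \<in> carrier R"
      using us w' stableD(1)[OF st] by auto
    have "u' \<in> part (\<lambda>_. True) S n" "w \<in> part (\<lambda>_. True) S n"
      using us(1) w' part_subset_part[of S _ "\<lambda>_. True", OF simple] by blast+
    then have "w \<ominus> u' \<in> part (\<lambda>_. True) S n" using stableD(5)[OF st] by blast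
    moreover have "s \<otimes> a = (w \<ominus> u') \<otimes> a"
    proof -
      have "s = u \<ominus> u'" using us c by (simp add: a_minus_def a_ac r_neg r_neg2)
      then have "s \<otimes> a = (u \<ominus> u') \<otimes> a" by simp
      also have "\<dots> = u \<otimes> a \<ominus> u' \<otimes> a"
        using stableD(1)[OF st u] c assms(2) by (simp add: a_minus_def l_distr l_minus)
      finally have "s \<otimes> a = u \<otimes> a \<ominus> u' \<otimes> a" .
      then show ?thesis using eq c assms(2) by (simp add: a_minus_def l_distr l_minus)
    qed
    ultimately have "s = \<zero>" using assms(1) us(2) unfolding indep_def by blast
    then have "u = u'" using us c by simp
    then show ?thesis using Suc.IH[of u P w] us w' eq by simp
  qed
  show ?case
  proof (cases "P n")
    case True
    then show ?thesis using step Suc.prems by blast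
  next
    case False
    \<comment> \<open>Exchanging the two selections reduces this to the previous case.\<close>
    then show ?thesis
      using step[of "\<lambda>n. \<not> P n" w u] Suc.prems by simp
  qed
qed

text \<open>The traces on \<open>V\<close> of the left ideals \<open>(\<Union>n. part (\<lambda>n. \<not> P n) S n) a <+> (part P S n) a\<close> would
  form an infinite ascending chain.\<close>
lemma indep_not_fin_len:
  assumes "indep a S" "a \<in> carrier R" and inf: "\<And>n. \<exists>m\<ge>n. P m" and V: "fin_len (carrier R) V"
    and cover: "\<And>x n. x \<in> part P S n \<Longrightarrow>
      \<exists>m. \<exists>e\<in>part (\<lambda>n. \<not> P n) S m. \<exists>v\<in>V. x \<otimes> a = e \<otimes> a \<oplus> v"
  shows False
proof -
  let ?Q = "\<lambda>n. \<not> P n"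
  let ?E = "\<Union>n. part ?Q S n"
  let ?im = "\<lambda>V. (\<lambda>x. x \<otimes> a) ` V"
  define Y where "Y n = V \<inter> (?im ?E <+> ?im (part P S n))" for n
  have simple: "\<And>n. simple_sub (carrier R) (S n)" using assms by (simp add: indep_def)
  have st: "\<And>P n. stable (carrier R) (part P S n)" using simple by (rule stable_part)
  have E: "stable (carrier R) ?E" using simple by (rule stable_Union_part)
  have sV: "stable (carrier R) V" using V by (rule fin_len_stable) simp
  have Ystable: "stable (carrier R) (Y n)" for n
    unfolding Y_def using st E sV assms(2)
    by (intro stable_Int stable_set_add stable_image_mult_right) auto
  have Ymono: "Y m \<subseteq> Y n" if "m \<le> n" for m n
  proof -
    have "part P S m \<subseteq> part P S n" using simple that by (rule part_mono)
    then show ?thesis unfolding Y_def set_add_def' by blast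
  qed
  have "finite (range Y)"
  proof (rule fin_len_chain_finite[OF V])
    show "stable (carrier R) X \<and> X \<subseteq> V" if "X \<in> range Y" for X
      using that Ystable by (auto simp: Y_def)
    fix X X' assume "X \<in> range Y" "X' \<in> range Y"
    then obtain m n where "X = Y m" "X' = Y n" by blast
    then show "X \<subseteq> X' \<or> X' \<subseteq> X" using Ymono nat_le_linear[of m n] by metis
  qed simp
  then obtain M where "M \<in> range Y" and max: "\<forall>X\<in>range Y. M \<subseteq> X \<longrightarrow> M = X"
    using finite_has_maximal[of "range Y"] by blast
  then obtain N where N: "M = Y N" by blast
  \<comment> \<open>A selected index from \<open>N\<close> on: here the trace can no longer grow,
    although \<open>S m\<close> is added.\<close>
  obtain m where m: "N \<le> m" "P m" using inf by blast
  obtain s where s: "s \<in> S m" "s \<noteq> \<zero>" using assms(1) unfolding indep_def by blast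
  have sS: "stable (carrier R) (S m)" using simple by (simp add: simple_sub_def)
  have s_part: "s \<in> part P S (Suc m)"
    using s(1) m(2) set_add_upper2[OF st[of P m]] stableD(1)[OF sS] by (simp add: subset_iff)
  obtain k e v where e: "e \<in> part ?Q S k" "v \<in> V" "s \<otimes> a = e \<otimes> a \<oplus> v"
    using cover[OF s_part] by blast
  have c: "s \<in> carrier R" "e \<in> carrier R" "v \<in> carrier R"
    using e s stableD(1)[OF sS] stableD(1)[OF st] stableD(1)[OF sV] by auto
  have "v = \<ominus> e \<otimes> a \<oplus> s \<otimes> a"
    using c assms(2) by (simp add: e(3) l_minus r_neg1 r_neg2)
  moreover have "\<ominus> e \<in> ?E" using e(1) stableD(4)[OF st] by blast
  ultimately have "v \<in> Y (Suc m)"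
    using s_part e(2) unfolding Y_def Int_iff mem_set_add by blast
  moreover have "Y (Suc m) = Y m"
  proof -
    have "Y N = Y m" "Y N = Y (Suc m)"
      using max Ymono m(1) N by (metis le_SucI rangeI)+
    then show ?thesis by simp
  qed
  ultimately have "v \<in> Y m" by simp
  then obtain e' l x where x: "e' \<in> part ?Q S l" "x \<in> part P S m" "v = e' \<otimes> a \<oplus> x \<otimes> a"
    unfolding Y_def Int_iff mem_set_add by blast
  have c': "e' \<in> carrier R" "x \<in> carrier R"
    using x stableD(1)[OF st] by auto
  \<comment> \<open>A common index beyond all the truncations involved.\<close>
  define h where "h = Suc m + k + l"
  have "e \<in> part ?Q S h" "e' \<in> part ?Q S h" "s \<in> part P S h" "x \<in> part P S h"
    using subsetD[OF part_mono[of S, OF simple] e(1), of h] subsetD[OF part_mono[of S, OF simple] x(1), of h]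
      subsetD[OF part_mono[of S, OF simple] s_part, of h] subsetD[OF part_mono[of S, OF simple] x(2), of h]
    by (simp_all add: h_def del: part.simps)
  then have "s \<ominus> x \<in> part P S h" "e \<oplus> e' \<in> part ?Q S h"
    using stableD(3,5)[OF st] by blast+
  moreover have "(s \<ominus> x) \<otimes> a = (e \<oplus> e') \<otimes> a"
  proof -
    have "(s \<ominus> x) \<otimes> a = s \<otimes> a \<ominus> x \<otimes> a"
      using c c' assms(2) by (simp add: a_minus_def l_distr l_minus)
    also have "\<dots> = (e \<otimes> a \<oplus> e' \<otimes> a) \<oplus> (x \<otimes> a \<oplus> \<ominus> (x \<otimes> a))"
      unfolding e(3) x(3) a_minus_def using c c' assms(2) by (simp only: a_assoc a_closed m_closed a_inv_closed)
    finally show ?thesis using c c' assms(2) by (simp add: r_neg l_distr)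
  qed
  \<comment> \<open>Independence makes both sides vanish, which puts \<open>s\<close> into the sum
    of the members before \<open>S m\<close>.\<close>
  ultimately have "s \<ominus> x = \<zero>" using indep_part[OF assms(1,2)] by blast
  then have "s = x" using c c' by (simp add: minus_eq_zero_iff)
  then have "s \<in> part (\<lambda>_. True) S m"
    using x(2) part_subset_part[of S P "\<lambda>_. True", OF simple] by blast
  then have "s = \<zero>" using assms(1) s(1) unfolding indep_def by blast
  with s(2) show False by simp
qed

section \<open>Elements mapping the socle to finite length\<close>

text \<open>Containment in some \<open>V\<close> of finite length avoids showing that submodules of
  such a \<open>V\<close> again have finite length.\<close>

definition fin_socle_image :: "'a \<Rightarrow> bool" where
  "fin_socle_image a \<longleftrightarrow> (\<exists>V. fin_len (carrier R) V \<and> (\<forall>s\<in>socle. s \<otimes> a \<in> V))"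

text \<open>Left multiples stay inside because the socle is two-sided:
  \<open>s \<otimes> (b \<otimes> x)\<close> is the image under \<open>x\<close> of
  \<open>s \<otimes> b\<close>, again a socle element.\<close>

lemma stable_fin_socle_image: "stable (carrier R) {a \<in> carrier R. fin_socle_image a}"
proof (rule left_idealI)
  show "\<zero> \<in> {a \<in> carrier R. fin_socle_image a}"
    unfolding fin_socle_image_def mem_Collect_eq
  proof (intro conjI exI ballI)
    show "s \<otimes> \<zero> \<in> {\<zero>}" if "s \<in> socle" for s
      using that socle_subset_carrier by auto
  qed (auto intro: fin_len.zero)
next
  fix x y assume "x \<in> {a \<in> carrier R. fin_socle_image a}" "y \<in> {a \<in> carrier R. fin_socle_image a}"
  then obtain V W where x: "x \<in> carrier R" "fin_len (carrier R) V" "\<forall>s\<in>socle. s \<otimes> x \<in> V"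
    and y: "y \<in> carrier R" "fin_len (carrier R) W" "\<forall>s\<in>socle. s \<otimes> y \<in> W"
    by (auto simp: fin_socle_image_def)
  then have "fin_len (carrier R) (V <+> W)" by (intro fin_len_set_add) auto
  moreover have "s \<otimes> (x \<oplus> y) \<in> V <+> W" if "s \<in> socle" for s
    using that x y socle_subset_carrier by (auto simp: r_distr mem_set_add subset_iff)
  ultimately show "x \<oplus> y \<in> {a \<in> carrier R. fin_socle_image a}"
    using x y by (auto simp: fin_socle_image_def)
next
  fix b x assume b: "b \<in> carrier R" and "x \<in> {a \<in> carrier R. fin_socle_image a}"
  then obtain V where x: "x \<in> carrier R" "fin_len (carrier R) V" "\<forall>s\<in>socle. s \<otimes> x \<in> V"
    by (auto simp: fin_socle_image_def)
  have "s \<otimes> (b \<otimes> x) \<in> V" if s: "s \<in> socle" for s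
    using x(3) socle_mult_right[OF s b] m_assoc[OF subsetD[OF socle_subset_carrier s] b x(1)]
    by force
  then show "b \<otimes> x \<in> {a \<in> carrier R. fin_socle_image a}"
    using b x by (auto simp: fin_socle_image_def)
qed auto

text \<open>If \<open>V\<close> has finite length, so has its image under \<open>a\<close>, which
  therefore cannot contain the image of every simple left ideal. Some \<open>S\<close> escapes it,
  and then so does each nonzero element of \<open>S\<close>, since it generates \<open>S\<close>.
  Iterating with \<open>V <+> S\<close> yields the sequence.\<close>

lemma exists_indep:
  assumes a: "a \<in> carrier R" and nf: "\<not> fin_socle_image a"
  obtains S where "indep a S"
proof -
  let ?C = "carrier R"
  let ?im = "\<lambda>V. (\<lambda>x. x \<otimes> a) ` V"
  have ex: "\<exists>S. simple_sub ?C S \<and> (\<exists>s\<in>S. s \<noteq> \<zero>) \<and> (\<forall>s\<in>S. s \<otimes> a \<in> ?im V \<longrightarrow> s = \<zero>)"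
    if V: "fin_len ?C V" for V
  proof -
    have imV: "fin_len ?C (?im V)" using V a by (rule fin_len_image)
    then have sV: "stable ?C (?im V)" by (rule fin_len_stable) simp
    have "\<exists>S. simple_sub ?C S \<and> \<not> ?im S \<subseteq> ?im V"
    proof (rule ccontr)
      assume H: "\<nexists>S. simple_sub ?C S \<and> \<not> ?im S \<subseteq> ?im V"
      have "socle \<subseteq> {x \<in> ?C. x \<otimes> a \<in> ?im V}"
      proof (rule socle_least)
        show "stable ?C {x \<in> ?C. x \<otimes> a \<in> ?im V}"
          using sV a by (rule stable_vimage_mult_right)
        fix S assume S: "simple_sub ?C S"
        then have "?im S \<subseteq> ?im V" using H by blast
        then show "S \<subseteq> {x \<in> ?C. x \<otimes> a \<in> ?im V}"
          using S stableD(1) unfolding simple_sub_def by blast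
      qed
      then have "fin_socle_image a" using imV unfolding fin_socle_image_def by blast
      with nf show False ..
    qed
    then obtain S where S: "simple_sub ?C S" and nsub: "\<not> ?im S \<subseteq> ?im V" by blast
    have sS: "stable ?C S" using S by (simp add: simple_sub_def)
    have "s = \<zero>" if s: "s \<in> S" "s \<otimes> a \<in> ?im V" for s
    proof (rule ccontr)
      assume s0: "s \<noteq> \<zero>"
      have "?im S \<subseteq> ?im V"
      proof
        fix y assume "y \<in> ?im S"
        then obtain t where t: "t \<in> S" "y = t \<otimes> a" by blast
        then obtain r where r: "r \<in> ?C" "t = r \<otimes> s" using S s s0 unfolding simple_sub_def by blast
        then have "y = r \<otimes> (s \<otimes> a)" using t a stableD(1)[OF sS s(1)] by (simp add: m_assoc)
        then show "y \<in> ?im V" using stableD(6)[OF sV r(1) s(2)] by simp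
      qed
      with nsub show False ..
    qed
    moreover have "\<exists>s\<in>S. s \<noteq> \<zero>"
    proof (rule ccontr)
      assume "\<not> (\<exists>s\<in>S. s \<noteq> \<zero>)"
      then have "?im S \<subseteq> {\<zero>}" using a by auto
      then show False using nsub stableD(2)[OF sV] by auto
    qed
    ultimately show ?thesis using S by blast
  qed
  define good where
    "good V S \<longleftrightarrow> simple_sub ?C S \<and> (\<exists>s\<in>S. s \<noteq> \<zero>) \<and> (\<forall>s\<in>S. s \<otimes> a \<in> ?im V \<longrightarrow> s = \<zero>)" for V S
  \<comment> \<open>The clause on \<open>n = 0\<close> fixes the start of the sequence, which
    dependent choice would otherwise leave open.\<close>
  have "\<exists>V. \<forall>n. (fin_len ?C (V n) \<and> (n = 0 \<longrightarrow> V n = {\<zero>})) \<and>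
      (\<exists>S. good (V n) S \<and> V (Suc n) = V n <+> S)"
  proof (rule dependent_nat_choice)
    show "\<exists>V. fin_len ?C V \<and> ((0::nat) = 0 \<longrightarrow> V = {\<zero>})" using fin_len.zero by blast
    fix V and n :: nat
    assume "fin_len ?C V \<and> (n = 0 \<longrightarrow> V = {\<zero>})"
    moreover from this ex obtain S where "good V S" unfolding good_def by blast
    ultimately show "\<exists>W. (fin_len ?C W \<and> (Suc n = 0 \<longrightarrow> W = {\<zero>})) \<and>
        (\<exists>S. good V S \<and> W = V <+> S)"
      using fin_len.add good_def by blast
  qed
  then obtain V where V: "V 0 = {\<zero>}" "\<forall>n. \<exists>S. good (V n) S \<and> V (Suc n) = V n <+> S" by blast
  from choice[OF V(2)] obtain S where S: "\<And>n. good (V n) (S n)" "\<And>n. V (Suc n) = V n <+> S n"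
    by blast
  have "part (\<lambda>_. True) S n = V n" for n
    by (induction n) (simp_all add: V(1) S(2))
  then have "indep a S" using S(1) by (simp add: indep_def good_def)
  then show ?thesis by (rule that)
qed

text \<open>If \<open>1\<close> were not in the left ideal \<open>K\<close> of all \<open>a\<close> for which \<open>socle a\<close> has finite length, take
  \<open>J / K\<close> simple and \<open>a\<close> in \<open>J\<close> but not in \<open>K\<close>. The projection of the socle onto the sum of every other
  member of a sequence independent under multiplication by \<open>a\<close> is multiplication by some \<open>r\<close>, and
  \<open>K + R r a\<close> would lie strictly between \<open>K\<close> and \<open>J\<close>.\<close>
lemma semiartinian_selfinjective_fin_socle:
  assumes semi: "left_semiartinian R" and inj: "left_selfinjective R"
  shows "fin_socle_image \<one>"
proof (rule ccontr)
  assume n1: "\<not> fin_socle_image \<one>"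
  let ?C = "carrier R"
  define K where "K = {a \<in> ?C. fin_socle_image a}"
  have K: "stable ?C K" unfolding K_def by (rule stable_fin_socle_image)
  have "\<one> \<notin> K" using n1 by (simp add: K_def)
  then have "K \<noteq> ?C" by auto
  then obtain J where J: "stable ?C J" "K \<subset> J"
    and min: "\<And>L. stable ?C L \<Longrightarrow> K \<subseteq> L \<Longrightarrow> L \<subseteq> J \<Longrightarrow> L = K \<or> L = J"
    using semi[unfolded left_semiartinian_def left_ideal_iff_stable, rule_format, OF conjI, OF K]
    by meson
  obtain a where aJ: "a \<in> J" "a \<notin> K" using J by blast
  then have a: "a \<in> ?C" "\<not> fin_socle_image a" using stableD(1)[OF J(1)] by (auto simp: K_def)
  obtain S where S: "indep a S" using exists_indep[OF a] by blast
  have simple: "\<And>n. simple_sub ?C (S n)" using S by (simp add: indep_def)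
  have st: "\<And>P n. stable ?C (part P S n)" using simple by (rule stable_part)
  \<comment> \<open>Written as a negation so that it is literally the complement of
    \<open>even\<close> in the lemmas on selections.\<close>
  let ?odd = "\<lambda>n::nat. \<not> even n"
  define U where "U = (\<Union>n. part even S n)"
  define Z where "Z = (\<Union>n. part ?odd S n)"
  have U: "stable ?C U" unfolding U_def using simple by (rule stable_Union_part)
  have Z: "stable ?C Z" unfolding Z_def using simple by (rule stable_Union_part)
  have "U \<inter> Z \<subseteq> {\<zero>}"
  proof
    fix x assume "x \<in> U \<inter> Z"
    then obtain m n where "x \<in> part even S m" "x \<in> part ?odd S n" by (auto simp: U_def Z_def)
    then have "x \<in> part even S (max m n)" "x \<in> part ?odd S (max m n)"
      using part_mono[OF simple] by (meson max.cobounded1 max.cobounded2 subsetD)+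
    then show "x \<in> {\<zero>}" using indep_part[OF S a(1)] by blast
  qed
  then have "U \<inter> Z = {\<zero>}" using stableD(2)[OF U] stableD(2)[OF Z] by blast
  then obtain W where W: "stable ?C W" "Z \<subseteq> W" "U \<inter> W = {\<zero>}" "socle \<subseteq> U <+> W"
    using exists_complement[OF U Z] by blast
  obtain r where r: "r \<in> ?C" "\<And>u w. u \<in> U \<Longrightarrow> w \<in> W \<Longrightarrow> (u \<oplus> w) \<otimes> r = u"
    using selfinjective_projection[OF inj U W(1,3)] by blast
  have socle_r: "s \<otimes> r \<in> U" if "s \<in> socle" for s
  proof -
    have "s \<in> U <+> W" using that W(4) by blast
    then obtain u w where "u \<in> U" "w \<in> W" "s = u \<oplus> w"
      unfolding mem_set_add by blast
    then show ?thesis using r(2) by simp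
  qed
  have U_r: "u \<otimes> r = u" if "u \<in> U" for u
    using r(2)[OF that stableD(2)[OF W(1)]] stableD(1)[OF U that] by simp
  have part_socle: "part P S n \<subseteq> socle" for P n
  proof (induction n)
    case 0
    then show ?case using stableD(2)[OF stable_socle] by simp
  next
    case (Suc n)
    then show ?case
      using simple_sub_subset_socle[OF simple] stableD(3)[OF stable_socle]
      by (auto simp: mem_set_add subset_iff)
  qed
  have ra: "r \<otimes> a \<in> ?C" "r \<otimes> a \<in> J" using r a aJ stableD(6)[OF J(1)] by auto
  have "r \<otimes> a \<notin> K"
  proof
    assume "r \<otimes> a \<in> K"
    then obtain V where V: "fin_len ?C V" "\<forall>s\<in>socle. s \<otimes> (r \<otimes> a) \<in> V"
      by (auto simp: K_def fin_socle_image_def)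
    \<comment> \<open>Since \<open>r\<close> fixes \<open>U\<close>, the even half is mapped by
      \<open>a\<close> as by \<open>r \<otimes> a\<close>, hence into \<open>V\<close>, and the
      contribution of the odd half can be taken to be zero.\<close>
    show False
    proof (rule indep_not_fin_len[OF S a(1) _ V(1), of even])
      show "\<exists>m\<ge>n. even m" for n :: nat by (rule exI[of _ "2 * n"]) simp
      fix x n assume x: "x \<in> part even S n"
      then have xU: "x \<in> U" and xs: "x \<in> socle" using part_socle by (auto simp: U_def)
      have xc: "x \<in> ?C" using stableD(1)[OF U xU] .
      have "x \<otimes> a \<in> V" using V(2) xs U_r[OF xU] m_assoc[OF xc r(1) a(1)] by force
      moreover have "x \<otimes> a = \<zero> \<otimes> a \<oplus> x \<otimes> a" using xc a by simp
      moreover have "\<zero> \<in> part ?odd S 0" by simp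
      ultimately show "\<exists>m. \<exists>e\<in>part ?odd S m. \<exists>v\<in>V. x \<otimes> a = e \<otimes> a \<oplus> v" by blast
    qed
  qed
  let ?P = "{t \<otimes> (r \<otimes> a) |t. t \<in> ?C}"
  have P: "stable ?C ?P" using ra(1) by (rule stable_principal)
  have KP: "stable ?C (K <+> ?P)" by (rule stable_set_add[OF subset_refl K P])
  have "K \<subseteq> K <+> ?P" using set_add_upper1[OF _ P] stableD(1)[OF K] by blast
  moreover have "K <+> ?P \<subseteq> J"
  proof
    fix y assume "y \<in> K <+> ?P"
    then obtain k t where "k \<in> K" "t \<in> ?C" "y = k \<oplus> t \<otimes> (r \<otimes> a)"
      unfolding mem_set_add by blast
    then show "y \<in> J" using J ra stableD(3,6)[OF J(1)] by blast
  qed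
  moreover have "r \<otimes> a \<in> K <+> ?P"
  proof -
    have "r \<otimes> a = \<one> \<otimes> (r \<otimes> a)" using ra by simp
    then have "r \<otimes> a \<in> ?P" by blast
    then show ?thesis using set_add_upper2[OF K] stableD(1)[OF P] by blast
  qed
  ultimately have "K <+> ?P = J" using min[OF KP] \<open>r \<otimes> a \<notin> K\<close> by blast
  then obtain k t where kt: "k \<in> K" "t \<in> ?C" "a = k \<oplus> t \<otimes> (r \<otimes> a)"
    using aJ(1) unfolding set_eq_iff mem_set_add by blast
  then obtain V where V: "fin_len ?C V" "\<forall>s\<in>socle. s \<otimes> k \<in> V" and k: "k \<in> ?C"
    by (auto simp: K_def fin_socle_image_def)
  show False
  proof (rule indep_not_fin_len[OF S a(1) _ V(1), of ?odd])
    show "\<exists>m\<ge>n. ?odd m" for n :: nat by (rule exI[of _ "2 * n + 1"]) simp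
    fix x n assume "x \<in> part ?odd S n"
    then have xs: "x \<in> socle" using part_socle by blast
    then have xc: "x \<in> ?C" using socle_subset_carrier by blast
    \<comment> \<open>After substituting for \<open>a\<close>, the element
      \<open>x \<otimes> t\<close> is again in the socle and \<open>r\<close> sends it into
      \<open>U\<close>. So the image of the odd half is covered by that of the even half up to
      \<open>V\<close>.\<close>
    have "x \<otimes> a = x \<otimes> (k \<oplus> t \<otimes> (r \<otimes> a))" using kt(3) by simp
    also have "\<dots> = (x \<otimes> t \<otimes> r) \<otimes> a \<oplus> x \<otimes> k"
      using xc k kt(2) r(1) a(1) by (simp add: r_distr m_assoc a_comm)
    finally have "x \<otimes> a = (x \<otimes> t \<otimes> r) \<otimes> a \<oplus> x \<otimes> k" .
    moreover have "x \<otimes> t \<otimes> r \<in> U" using socle_r socle_mult_right[OF xs kt(2)] by blast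
    then obtain m where "x \<otimes> t \<otimes> r \<in> part even S m" unfolding U_def by blast
    then have "x \<otimes> t \<otimes> r \<in> part (\<lambda>n. \<not> ?odd n) S m" by simp
    ultimately show "\<exists>m. \<exists>e\<in>part (\<lambda>n. \<not> ?odd n) S m. \<exists>v\<in>V. x \<otimes> a = e \<otimes> a \<oplus> v"
      using V(2) xs by blast
  qed
qed

section \<open>From the socle to the zero ideal and chain conditions\<close>

text \<open>When \<open>V \<inter> I\<close> is zero, \<open>(V <+> S) \<inter> I\<close> embeds
  into a quotient of \<open>S\<close>, so it is zero or simple. If it contains a nonzero
  \<open>y\<close>, separation and directedness give a smaller \<open>L\<close> without
  \<open>y\<close>, and a proper submodule of a simple module is zero.\<close>

lemma fin_len_disjoint_ideal:
  assumes "fin_len (carrier R) V" and "\<I> \<noteq> {}" "\<And>I. I \<in> \<I> \<Longrightarrow> stable (carrier R) I"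
    and dir: "\<And>I J. I \<in> \<I> \<Longrightarrow> J \<in> \<I> \<Longrightarrow> \<exists>L\<in>\<I>. L \<subseteq> I \<inter> J" and sep: "\<Inter>\<I> = {\<zero>}"
  shows "\<exists>I\<in>\<I>. V \<inter> I = {\<zero>}"
  using assms(1)
proof induction
  case zero
  then show ?case using assms(2,3) stableD(2) by blast
next
  case (add V S)
  then obtain I where I: "I \<in> \<I>" "V \<inter> I = {\<zero>}" by blast
  have sI: "stable (carrier R) I" using I assms(3) by blast
  have sV: "stable (carrier R) V" using add.hyps(1) by (rule fin_len_stable) simp
  have sS: "stable (carrier R) S" using add.hyps(2) by (simp add: simple_sub_def)
  have sVS: "stable (carrier R) (V <+> S)" by (rule stable_set_add[OF subset_refl sV sS])
  show ?case
  proof (cases "(V <+> S) \<inter> I \<subseteq> {\<zero>}")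
    case True
    then show ?thesis using I(1) stableD(2)[OF sVS] stableD(2)[OF sI] by blast
  next
    case False
    then obtain y where y: "y \<in> V <+> S" "y \<in> I" "y \<noteq> \<zero>" by blast
    then have "y \<notin> \<Inter>\<I>" using sep by simp
    then obtain I' where "I' \<in> \<I>" "y \<notin> I'" by blast
    then obtain L where L: "L \<in> \<I>" "L \<subseteq> I" "y \<notin> L" using dir[OF I(1), of I'] by blast
    have sL: "stable (carrier R) L" using L assms(3) by blast
    have "(V <+> S) \<inter> L \<subseteq> {\<zero>}"
    proof (rule ccontr)
      assume "\<not> (V <+> S) \<inter> L \<subseteq> {\<zero>}"
      then obtain z where z: "z \<in> V <+> S" "z \<in> L" "z \<noteq> \<zero>" by blast
      obtain v s where vs: "v \<in> V" "s \<in> S" "y = v \<oplus> s" using y unfolding mem_set_add by blast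
      obtain v' s' where vs': "v' \<in> V" "s' \<in> S" "z = v' \<oplus> s'" using z unfolding mem_set_add by blast
      have c: "v \<in> carrier R" "s \<in> carrier R" "v' \<in> carrier R" "s' \<in> carrier R"
        using vs vs' stableD(1)[OF sV] stableD(1)[OF sS] by auto
      have "s' \<noteq> \<zero>"
      proof
        assume "s' = \<zero>"
        then have "z \<in> V \<inter> I" using vs' c z L by auto
        then show False using I(2) z(3) by blast
      qed
      then obtain r where r: "r \<in> carrier R" "s = r \<otimes> s'"
        using add.hyps(2) vs vs' unfolding simple_sub_def by blast
      \<comment> \<open>The components in \<open>S\<close> cancel, so the difference lies in
        \<open>V \<inter> I\<close> and vanishes; then \<open>y\<close> is a multiple of
        \<open>z\<close> and falls into \<open>L\<close>.\<close>
      have "y \<ominus> r \<otimes> z = v \<ominus> r \<otimes> v'"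
        unfolding vs vs' r using c r
        by (simp add: a_minus_def minus_add r_distr r_minus a_ac r_neg1 r_neg2)
      moreover have "v \<ominus> r \<otimes> v' \<in> V" using vs(1) vs'(1) r(1) stableD(5,6)[OF sV] by blast
      moreover have rz: "r \<otimes> z \<in> L" using r z stableD(6)[OF sL] by blast
      then have "y \<ominus> r \<otimes> z \<in> I" using y L stableD(5)[OF sI] by blast
      ultimately have "y \<ominus> r \<otimes> z = \<zero>" using I(2) by auto
      then have "y = r \<otimes> z"
        using stableD(1)[OF sI y(2)] stableD(1)[OF sL rz] by (simp add: minus_eq_zero_iff)
      then show False using rz L(3) by simp
    qed
    then show ?thesis using L(1) stableD(2)[OF sVS] stableD(2)[OF sL] by blast
  qed
qed

lemma profinite_zero_mem:
  assumes "left_semiartinian R" "left_selfinjective R"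
    and "\<I> \<noteq> {}" "\<And>I. I \<in> \<I> \<Longrightarrow> stable (carrier R) I"
    and "\<And>I J. I \<in> \<I> \<Longrightarrow> J \<in> \<I> \<Longrightarrow> \<exists>L\<in>\<I>. L \<subseteq> I \<inter> J" and "\<Inter>\<I> = {\<zero>}"
  shows "{\<zero>} \<in> \<I>"
proof -
  obtain V where V: "fin_len (carrier R) V" "\<forall>s\<in>socle. s \<otimes> \<one> \<in> V"
    using semiartinian_selfinjective_fin_socle[OF assms(1,2)] by (auto simp: fin_socle_image_def)
  then have soc: "socle \<subseteq> V" using subsetD[OF socle_subset_carrier] by force
  obtain I where I: "I \<in> \<I>" "V \<inter> I = {\<zero>}"
    using fin_len_disjoint_ideal[OF V(1) assms(3-6)] by blast
  have "I = {\<zero>}"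
  proof (rule ccontr)
    assume "I \<noteq> {\<zero>}"
    then obtain S s where "simple_sub (carrier R) S" "S \<subseteq> I" "s \<in> S" "s \<noteq> \<zero>"
      using semiartinian_simple_sub[OF assms(1) assms(4)[OF I(1)]] by blast
    then show False using soc I(2) simple_sub_subset_socle by blast
  qed
  then show ?thesis using I by simp
qed

text \<open>Left ideals are in particular \<open>B\<close>-stable, so a descending sequence of them
  has finitely many members. With \<open>B\<close> the scalars, this is the passage from finite
  dimension to artinian.\<close>

lemma fin_len_left_artinian:
  assumes "fin_len B (carrier R)" "B \<subseteq> carrier R"
  shows "left_artinian R"
  unfolding left_artinian_def left_ideal_iff_stable
proof (intro allI impI)
  fix I :: "nat \<Rightarrow> 'a set"
  assume I: "\<forall>n. stable (carrier R) (I n) \<and> I (Suc n) \<subseteq> I n"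
  then have anti: "I n \<subseteq> I m" if "m \<le> n" for m n
    using lift_Suc_antimono_le[of I] that by blast
  have "finite (range I)"
  proof (rule fin_len_chain_finite[OF assms])
    show "stable B X \<and> X \<subseteq> carrier R" if "X \<in> range I" for X
      using that I assms(2) stable_mono stableD(1) by blast
    fix X Y assume "X \<in> range I" "Y \<in> range I"
    then obtain m n where "X = I m" "Y = I n" by blast
    then show "X \<subseteq> Y \<or> Y \<subseteq> X" using anti nat_le_linear[of m n] by metis
  qed
  then obtain M where "M \<in> range I" and min: "\<forall>X\<in>range I. X \<subseteq> M \<longrightarrow> M = X"
    using finite_has_minimal[of "range I"] by blast
  then obtain N where "M = I N" by blast
  then show "\<exists>N. \<forall>n\<ge>N. I n = I N" using min anti by (metis rangeI)
qed

end

section \<open>Finite dimension as length over the scalars\<close>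

lemma fin_dim_fin_len:
  assumes alg: "k_algebra K A" and "fin_dim K A"
  defines "B \<equiv> (\<lambda>c. c \<odot>\<^bsub>A\<^esub> \<one>\<^bsub>A\<^esub>) ` carrier K"
  shows "B \<subseteq> carrier A" "ring.fin_len A B (carrier A)"
proof -
  interpret K: field K using alg by (simp add: k_algebra_def)
  interpret A: ring A using alg by (simp add: k_algebra_def)
  interpret M: module K A using alg by (simp add: k_algebra_def)
  have smult: "(c \<odot>\<^bsub>A\<^esub> \<one>\<^bsub>A\<^esub>) \<otimes>\<^bsub>A\<^esub> x = c \<odot>\<^bsub>A\<^esub> x" if "c \<in> carrier K" "x \<in> carrier A" for c x
    using alg that unfolding k_algebra_def by auto
  show B: "B \<subseteq> carrier A" unfolding B_def by auto
  \<comment> \<open>Lines are simple because nonzero scalars are invertible. Here \<open>x\<close>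
    may be zero, as the zero submodule counts as simple, so any finite spanning set will do in place
    of a basis.\<close>
  have simple: "A.simple_sub B {c \<odot>\<^bsub>A\<^esub> x |c. c \<in> carrier K}" if x: "x \<in> carrier A" for x
    unfolding A.simple_sub_def
  proof (intro conjI ballI impI)
    show "A.stable B {c \<odot>\<^bsub>A\<^esub> x |c. c \<in> carrier K}"
    proof (rule A.stableI)
      show "\<zero>\<^bsub>A\<^esub> \<in> {c \<odot>\<^bsub>A\<^esub> x |c. c \<in> carrier K}"
        using M.smult_l_null[OF x] by (metis (mono_tags, lifting) K.zero_closed mem_Collect_eq)
    next
      fix y z assume "y \<in> {c \<odot>\<^bsub>A\<^esub> x |c. c \<in> carrier K}" "z \<in> {c \<odot>\<^bsub>A\<^esub> x |c. c \<in> carrier K}"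
      then obtain c d where "c \<in> carrier K" "d \<in> carrier K" "y = c \<odot>\<^bsub>A\<^esub> x" "z = d \<odot>\<^bsub>A\<^esub> x" by blast
      moreover from this have "y \<oplus>\<^bsub>A\<^esub> z = (c \<oplus>\<^bsub>K\<^esub> d) \<odot>\<^bsub>A\<^esub> x" using x by (simp add: M.smult_l_distr)
      ultimately show "y \<oplus>\<^bsub>A\<^esub> z \<in> {c \<odot>\<^bsub>A\<^esub> x |c. c \<in> carrier K}" by blast
    next
      fix y assume "y \<in> {c \<odot>\<^bsub>A\<^esub> x |c. c \<in> carrier K}"
      then obtain c where "c \<in> carrier K" "y = c \<odot>\<^bsub>A\<^esub> x" by blast
      moreover from this have "\<ominus>\<^bsub>A\<^esub> y = (\<ominus>\<^bsub>K\<^esub> c) \<odot>\<^bsub>A\<^esub> x" using x by (simp add: M.smult_l_minus)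
      ultimately show "\<ominus>\<^bsub>A\<^esub> y \<in> {c \<odot>\<^bsub>A\<^esub> x |c. c \<in> carrier K}" by blast
    next
      fix b y assume "b \<in> B" "y \<in> {c \<odot>\<^bsub>A\<^esub> x |c. c \<in> carrier K}"
      then obtain c d where cd: "c \<in> carrier K" "d \<in> carrier K" "y = c \<odot>\<^bsub>A\<^esub> x" "b = d \<odot>\<^bsub>A\<^esub> \<one>\<^bsub>A\<^esub>"
        unfolding B_def by blast
      then have "b \<otimes>\<^bsub>A\<^esub> y = (d \<otimes>\<^bsub>K\<^esub> c) \<odot>\<^bsub>A\<^esub> x" using x smult by (simp add: M.smult_assoc1)
      then show "b \<otimes>\<^bsub>A\<^esub> y \<in> {c \<odot>\<^bsub>A\<^esub> x |c. c \<in> carrier K}" using cd by blast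
    qed (use x in auto)
    fix s t assume "s \<in> {c \<odot>\<^bsub>A\<^esub> x |c. c \<in> carrier K}" "s \<noteq> \<zero>\<^bsub>A\<^esub>" "t \<in> {c \<odot>\<^bsub>A\<^esub> x |c. c \<in> carrier K}"
    then obtain c d where cd: "c \<in> carrier K" "d \<in> carrier K" "s = c \<odot>\<^bsub>A\<^esub> x" "t = d \<odot>\<^bsub>A\<^esub> x"
      and "s \<noteq> \<zero>\<^bsub>A\<^esub>" by blast
    then have "c \<noteq> \<zero>\<^bsub>K\<^esub>" using x M.smult_l_null by auto
    then have inv: "inv\<^bsub>K\<^esub> c \<in> carrier K" "inv\<^bsub>K\<^esub> c \<otimes>\<^bsub>K\<^esub> c = \<one>\<^bsub>K\<^esub>"
      using cd(1) by (auto simp: K.field_Units)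
    have "((d \<otimes>\<^bsub>K\<^esub> inv\<^bsub>K\<^esub> c) \<odot>\<^bsub>A\<^esub> \<one>\<^bsub>A\<^esub>) \<otimes>\<^bsub>A\<^esub> s = ((d \<otimes>\<^bsub>K\<^esub> inv\<^bsub>K\<^esub> c) \<otimes>\<^bsub>K\<^esub> c) \<odot>\<^bsub>A\<^esub> x"
      using smult[of "d \<otimes>\<^bsub>K\<^esub> inv\<^bsub>K\<^esub> c" s] cd(1-3) inv(1) x M.smult_assoc1[of "d \<otimes>\<^bsub>K\<^esub> inv\<^bsub>K\<^esub> c" c x] by simp
    also have "\<dots> = t" using cd inv by (simp add: K.m_assoc)
    finally show "\<exists>r\<in>B. t = r \<otimes>\<^bsub>A\<^esub> s" using cd inv unfolding B_def by blast
  qed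
  have span: "\<exists>V. A.fin_len B V \<and> S \<subseteq> V" if "finite S" "S \<subseteq> carrier A" for S
    using that
  proof (induction rule: finite_induct)
    case empty
    then show ?case using A.fin_len.zero by blast
  next
    case (insert x S)
    then obtain V where V: "A.fin_len B V" "S \<subseteq> V" by auto
    let ?L = "{c \<odot>\<^bsub>A\<^esub> x |c. c \<in> carrier K}"
    have L: "A.simple_sub B ?L" using simple insert.prems by simp
    have sL: "A.stable B ?L" using L by (simp add: A.simple_sub_def)
    have sV: "A.stable B V" using V(1) B by (rule A.fin_len_stable)
    have "x = \<one>\<^bsub>K\<^esub> \<odot>\<^bsub>A\<^esub> x" using insert.prems by simp
    then have "x \<in> ?L" by blast
    then have "insert x S \<subseteq> V <+>\<^bsub>A\<^esub> ?L"
      using V(2) A.set_add_upper1[OF _ sL, of V] A.set_add_upper2[OF sV, of ?L]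
        A.stableD(1)[OF sV] A.stableD(1)[OF sL] by blast
    then show ?case using A.fin_len.add[OF V(1) L] by blast
  qed
  obtain S where S: "finite S" "S \<subseteq> carrier A"
    "\<And>x. x \<in> carrier A \<Longrightarrow> \<exists>c. c \<in> S \<rightarrow> carrier K \<and>
        (\<exists>i\<in>{\<zero>\<^bsub>A\<^esub>}. x = (\<Oplus>\<^bsub>A\<^esub>s\<in>S. c s \<odot>\<^bsub>A\<^esub> s) \<oplus>\<^bsub>A\<^esub> i)"
    using assms(2) unfolding fin_dim_def fin_codim_def by blast
  obtain V where V: "A.fin_len B V" "S \<subseteq> V" using span[OF S(1,2)] by blast
  have sV: "A.stable B V" using V(1) B by (rule A.fin_len_stable)
  have "x \<in> V" if x: "x \<in> carrier A" for x
  proof -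
    obtain c where c: "c \<in> S \<rightarrow> carrier K" "x = (\<Oplus>\<^bsub>A\<^esub>s\<in>S. c s \<odot>\<^bsub>A\<^esub> s) \<oplus>\<^bsub>A\<^esub> \<zero>\<^bsub>A\<^esub>"
      using S(3)[OF x] by blast
    have mem: "c s \<odot>\<^bsub>A\<^esub> s \<in> V" if s: "s \<in> S" for s
    proof -
      have "c s \<in> carrier K" using c s by auto
      moreover from this have "(c s \<odot>\<^bsub>A\<^esub> \<one>\<^bsub>A\<^esub>) \<otimes>\<^bsub>A\<^esub> s \<in> V"
        using V(2) s by (intro A.stableD(6)[OF sV]) (auto simp: B_def)
      ultimately show ?thesis using smult s S(2) by auto
    qed
    \<comment> \<open>Passing to subsets lets the induction run while the coefficients
      \<open>c\<close> on \<open>S\<close> stay fixed.\<close>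
    have "F \<subseteq> S \<Longrightarrow> (\<Oplus>\<^bsub>A\<^esub>s\<in>F. c s \<odot>\<^bsub>A\<^esub> s) \<in> V" if "finite F" for F
      using that
    proof (induction rule: finite_induct)
      case empty
      then show ?case using A.stableD(2)[OF sV] by simp
    next
      case (insert s F)
      then have "(\<Oplus>\<^bsub>A\<^esub>s\<in>insert s F. c s \<odot>\<^bsub>A\<^esub> s) = c s \<odot>\<^bsub>A\<^esub> s \<oplus>\<^bsub>A\<^esub> (\<Oplus>\<^bsub>A\<^esub>s\<in>F. c s \<odot>\<^bsub>A\<^esub> s)"
        using mem A.stableD(1)[OF sV] by (intro A.finsum_insert) auto
      then show ?case using insert mem A.stableD(3)[OF sV] by simp
    qed
    from this[OF S(1)] have sumV: "(\<Oplus>\<^bsub>A\<^esub>s\<in>S. c s \<odot>\<^bsub>A\<^esub> s) \<in> V" by simp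
    then show ?thesis using c(2) A.stableD(1)[OF sV] by simp
  qed
  then have "V = carrier A" using A.stableD(1)[OF sV] by blast
  then show "A.fin_len B (carrier A)" using V(1) by simp
qed

theorem theorem5p2:
  fixes K :: "('k, 'm) ring_scheme" and A :: "('k, 'a, 'n) module_scheme"
  assumes "profinite_algebra K A"
    and "left_semiartinian A"
    and "left_selfinjective A"
  shows "fin_dim K A \<and> quasi_frobenius A"
proof -
  have alg: "k_algebra K A" using assms(1) by (simp add: profinite_algebra_def)
  interpret A: ring A using alg by (simp add: k_algebra_def)
  obtain \<I> where "\<I> \<noteq> {}" "\<forall>I\<in>\<I>. ideal I A \<and> fin_codim K A I"
    "\<forall>I\<in>\<I>. \<forall>J\<in>\<I>. \<exists>L\<in>\<I>. L \<subseteq> I \<inter> J" "\<Inter>\<I> = {\<zero>\<^bsub>A\<^esub>}"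
    using assms(1) unfolding profinite_algebra_def by (elim conjE exE) (rule that)
  then have I: "\<I> \<noteq> {}" "\<And>I. I \<in> \<I> \<Longrightarrow> ideal I A \<and> fin_codim K A I"
    "\<And>I J. I \<in> \<I> \<Longrightarrow> J \<in> \<I> \<Longrightarrow> \<exists>L\<in>\<I>. L \<subseteq> I \<inter> J" "\<Inter>\<I> = {\<zero>\<^bsub>A\<^esub>}"
    by simp_all
  have "A.stable (carrier A) I" if "I \<in> \<I>" for I
  proof -
    interpret ideal I A using I(2)[OF that] by simp
    show ?thesis
      unfolding A.stable_def by (simp add: is_additive_subgroup I_l_closed)
  qed
  then have "{\<zero>\<^bsub>A\<^esub>} \<in> \<I>"
    using A.profinite_zero_mem[OF assms(2,3) I(1) _ I(3,4)] by blast
  then have fd: "fin_dim K A" using I(2) by (simp add: fin_dim_def)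
  then have "left_artinian A"
    using A.fin_len_left_artinian fin_dim_fin_len[OF alg fd] by blast
  then show ?thesis using fd assms(3) by (simp add: quasi_frobenius_def)
qed

end
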